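(* Let $k\ge1$ be an integer and suppose that for each $n$ there exists a graph $G_n$ on $n$ vertices with girth $2k+2$ and $m=\Omega(n^{1+1/k})$ edges. Then, in the message-passing model without edge duplication (already with a single player besides the coordinator), the randomized communication cost of the multiplicative $(2k-1)$-approximate distance oracle problem on $n$-vertex graphs is $\Omega(n^{1+1/k})$ bits.
   Context: Message-passing model: players $P^1,\dots,P^s$ and a coordinator; all know the vertex set $V$, $|V|=n$; player $P^i$ holds an edge set $E_i$, pairwise disjoint (no duplication), and the input graph is $G=(V,\bigcup_i E_i)$ (unweighted, undirected). Communication is only between the coordinator and individual players; communication cost is the total number of bits exchanged; randomized protocols must succeed with probability at least $2/3$. In the multiplicative $(2k-1)$-approximate distance oracle problem, the coordinator must end up with an oracle $O_G$ which, for any queried pair of vertices $v,w$, returns a value with $d_G(v,w)\le O_G(v,w)\le (2k-1)\,d_G(v,w)$. *)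

theory Defs
  imports "HOL-Probability.Probability_Mass_Function" "HOL-Library.Landau_Symbols"
begin

text \<open>A simple undirected graph on the vertex set \<open>{..<n}\<close> is represented by its edge set,
  a subset of the following set.\<close>

definition all_edges :: "nat \<Rightarrow> nat set set" where
  "all_edges n = {e. e \<subseteq> {..<n} \<and> card e = 2}"

definition walk :: "'a set set \<Rightarrow> 'a list \<Rightarrow> bool" where
  "walk E xs \<longleftrightarrow> xs \<noteq> [] \<and> successively (\<lambda>u v. {u, v} \<in> E) xs"

text \<open>The distance is \<open>\<infinity>\<close> if there is no connecting walk.\<close>

definition graph_dist :: "'a set set \<Rightarrow> 'a \<Rightarrow> 'a \<Rightarrow> enat" where
  "graph_dist E u v =
     (INF xs \<in> {xs. walk E xs \<and> hd xs = u \<and> last xs = v}. enat (length xs - 1))"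

text \<open>A cycle lists its vertices once each; its length is the length of the list.\<close>

definition cycle :: "'a set set \<Rightarrow> 'a list \<Rightarrow> bool" where
  "cycle E xs \<longleftrightarrow> length xs \<ge> 3 \<and> distinct xs \<and> walk E xs \<and> {last xs, hd xs} \<in> E"

definition girth :: "'a set set \<Rightarrow> enat" where
  "girth E = (INF xs \<in> {xs. cycle E xs}. enat (length xs))"

text \<open>Communication is modelled bit by bit. The coordinator has no input and takes part in every
  exchange, so its deterministic strategy is a (well-founded) decision tree: it stops with a result,
  sends a bit to player \<open>i\<close>, or reads a bit from player \<open>i\<close> and continues depending on that bit.
  Silence carries no information: every read transmits exactly one bit, which is paid for.\<close>

datatype 'r coordinator =
    Output 'r
  | Send nat bool "'r coordinator"
  | Receive nat "bool \<Rightarrow> 'r coordinator"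

primrec contacted :: "'r coordinator \<Rightarrow> nat set" where
  "contacted (Output r) = {}"
| "contacted (Send i b c) = insert i (contacted c)"
| "contacted (Receive i f) = insert i (\<Union>b. contacted (f b))"

datatype channel_bit = From_Coordinator bool | From_Player bool

text \<open>A player's next bit depends only on its own edge set and on the bits exchanged so far
  between it and the coordinator. In a protocol \<open>(c, \<sigma>)\<close>, \<open>\<sigma> i\<close> is the strategy of player \<open>i\<close>.\<close>

type_synonym player = "nat set set \<Rightarrow> channel_bit list \<Rightarrow> bool"
type_synonym 'r protocol = "'r coordinator \<times> (nat \<Rightarrow> player)"

text \<open>\<open>run c \<sigma> E h\<close> yields the coordinator's result and the number of bits exchanged, where
  player \<open>i\<close> holds the edge set \<open>E i\<close> and \<open>h i\<close> is what has already passed through its channel.\<close>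

primrec run :: "'r coordinator \<Rightarrow> (nat \<Rightarrow> player) \<Rightarrow> (nat \<Rightarrow> nat set set) \<Rightarrow>
    (nat \<Rightarrow> channel_bit list) \<Rightarrow> 'r \<times> nat" where
  "run (Output r) \<sigma> E h = (r, 0)"
| "run (Send i b c) \<sigma> E h = apsnd Suc (run c \<sigma> E (h(i := h i @ [From_Coordinator b])))"
| "run (Receive i f) \<sigma> E h = apsnd Suc
     (run (f (\<sigma> i (E i) (h i))) \<sigma> E (h(i := h i @ [From_Player (\<sigma> i (E i) (h i))])))"

definition result :: "'r protocol \<Rightarrow> (nat \<Rightarrow> nat set set) \<Rightarrow> 'r" where
  "result D E = fst (run (fst D) (snd D) E (\<lambda>i. []))"

definition bits :: "'r protocol \<Rightarrow> (nat \<Rightarrow> nat set set) \<Rightarrow> nat" where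
  "bits D E = snd (run (fst D) (snd D) E (\<lambda>i. []))"

text \<open>The players are \<open>0, \<dots>, s - 1\<close>. Disjointness is the absence of edge duplication.\<close>

definition inputs :: "nat \<Rightarrow> nat \<Rightarrow> (nat \<Rightarrow> nat set set) set" where
  "inputs n s = {E. (\<forall>i<s. E i \<subseteq> all_edges n) \<and> disjoint_family_on E {..<s}}"

text \<open>A randomized (public-coin) protocol is a distribution over deterministic ones; protocols with
  private coins are a special case. A problem \<open>P\<close> relates the input graph to the admissible results.\<close>

definition solves :: "nat \<Rightarrow> nat \<Rightarrow> (nat set set \<Rightarrow> 'r \<Rightarrow> bool) \<Rightarrow> 'r protocol pmf \<Rightarrow> bool" where
  "solves n s P \<rho> \<longleftrightarrow>
     (\<forall>D \<in> set_pmf \<rho>. contacted (fst D) \<subseteq> {..<s}) \<and>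
     (\<forall>E \<in> inputs n s. measure_pmf.prob \<rho> {D. P (\<Union>i<s. E i) (result D E)} \<ge> 2 / 3)"

text \<open>Worst case over inputs and coin tosses.\<close>

definition cost :: "nat \<Rightarrow> nat \<Rightarrow> 'r protocol pmf \<Rightarrow> enat" where
  "cost n s \<rho> = (SUP D \<in> set_pmf \<rho>. SUP E \<in> inputs n s. enat (bits D E))"

definition randomized_cost :: "nat \<Rightarrow> nat \<Rightarrow> (nat set set \<Rightarrow> 'r \<Rightarrow> bool) \<Rightarrow> enat" where
  "randomized_cost n s P = (INF \<rho> \<in> {\<rho>. solves n s P \<rho>}. cost n s \<rho>)"

definition distance_oracle :: "nat \<Rightarrow> real \<Rightarrow> nat set set \<Rightarrow> (nat \<Rightarrow> nat \<Rightarrow> ereal) \<Rightarrow> bool" where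
  "distance_oracle n \<alpha> E Q \<longleftrightarrow>
     (\<forall>v<n. \<forall>w<n. ereal_of_enat (graph_dist E v w) \<le> Q v w \<and>
                   Q v w \<le> ereal \<alpha> * ereal_of_enat (graph_dist E v w))"

end

theory Submission
  imports Defs
begin

text \<open>Let \<open>H\<close> be a graph of girth \<open>2k + 2\<close> with \<open>m\<close> edges, and give a subgraph \<open>S \<subseteq> H\<close> to a
  single player. An edge of \<open>H\<close> has distance \<open>1\<close> in \<open>S\<close> if it belongs to \<open>S\<close>, and distance at least
  \<open>2k + 1\<close> otherwise, since a shorter detour would close a short cycle. So a
  \<open>(2k - 1)\<close>-approximate oracle determines \<open>S\<close>. By averaging, some deterministic
  protocol in the support is correct for two thirds of the \<open>2\<^sup>m\<close> subgraphs, while \<open>b\<close> bits yield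
  at most \<open>2\<^sup>b\<close> results; hence \<open>b \<ge> m\<close>.\<close>

text \<open>Cutting out the closed segment between two occurrences of a vertex keeps both ends and
  shortens the walk, so induction on the length applies.\<close>

lemma walk_imp_distinct_walk:
  assumes "walk E xs"
  shows "\<exists>ys. walk E ys \<and> distinct ys \<and> hd ys = hd xs \<and> last ys = last xs \<and> length ys \<le> length xs"
  using assms
proof (induction xs rule: length_induct)
  case (1 xs)
  show ?case
  proof (cases "distinct xs")
    case True
    with 1 show ?thesis by blast
  next
    case False
    then obtain as y bs cs where xs: "xs = as @ [y] @ bs @ [y] @ cs"
      using not_distinct_decomp by blast
    let ?zs = "as @ [y] @ cs"
    have "walk E ?zs" "hd ?zs = hd xs" "last ?zs = last xs" "length ?zs < length xs"
      using 1(2) unfolding xs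
      by (auto simp: walk_def successively_append_iff successively_Cons hd_append)
    then show ?thesis using 1(1) by (metis less_imp_le order_trans)
  qed
qed

text \<open>Once repetitions are cut out, the walk is a path that the edge \<open>{u, v}\<close>
  closes to a cycle in \<open>E\<close>. As cycles are measured by their number of vertices, the
  closing edge is already counted in \<open>length xs\<close>.\<close>

lemma girth_le_length_detour:
  assumes "walk S xs" "hd xs = u" "last xs = v" "u \<noteq> v"
    and "S \<subseteq> E" "{u, v} \<in> E" "{u, v} \<notin> S"
  shows "girth E \<le> enat (length xs)"
proof -
  obtain ys where ys: "walk S ys" "distinct ys" "hd ys = u" "last ys = v" "length ys \<le> length xs"
    using walk_imp_distinct_walk[OF assms(1)] assms(2,3) by auto
  \<comment> \<open>One vertex would force \<open>u = v\<close>, and two would put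
    \<open>{u, v}\<close> into \<open>S\<close>.\<close>
  have "length ys \<ge> 3"
  proof (rule ccontr)
    assume "\<not> length ys \<ge> 3"
    then have "length ys = 0 \<or> length ys = 1 \<or> length ys = 2" by linarith
    then show False
      using ys assms by (auto simp: walk_def length_Suc_conv numeral_2_eq_2)
  qed
  moreover have "walk E ys"
    using ys(1) assms(5) by (auto simp: walk_def elim: successively_mono)
  ultimately have "cycle E ys"
    using ys assms(6) by (simp add: cycle_def insert_commute)
  then have "girth E \<le> enat (length ys)"
    unfolding girth_def by (intro INF_lower) simp
  also have "\<dots> \<le> enat (length xs)" using ys(5) by simp
  finally show ?thesis .
qed

lemma girth_le_graph_dist_Suc:
  assumes "u \<noteq> v" "S \<subseteq> E" "{u, v} \<in> E" "{u, v} \<notin> S"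
  shows "girth E \<le> graph_dist S u v + 1"
proof (cases "graph_dist S u v")
  case (enat d)
  let ?W = "{xs. walk S xs \<and> hd xs = u \<and> last xs = v}"
  \<comment> \<open>An infimum over no walks would be \<open>\<infinity>\<close>. With a walk at
    hand, the well-order on \<open>enat\<close> makes the infimum attained.\<close>
  have "?W \<noteq> {}"
  proof
    assume "?W = {}"
    then have "graph_dist S u v = \<infinity>"
      unfolding graph_dist_def by (simp only: image_empty Inf_empty top_enat_def)
    with enat show False by simp
  qed
  then have "graph_dist S u v \<in> (\<lambda>xs. enat (length xs - 1)) ` ?W"
    unfolding graph_dist_def by (metis (no_types, lifting) all_not_in_conv imageI wellorder_InfI)
  then obtain xs where xs: "walk S xs" "hd xs = u" "last xs = v"
    "graph_dist S u v = enat (length xs - 1)"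
    by auto
  have "girth E \<le> enat (length xs)"
    using girth_le_length_detour[OF xs(1-3)] assms by blast
  \<comment> \<open>Nonemptiness keeps the subtraction in \<open>length xs - 1\<close> from
    truncating.\<close>
  moreover have "length xs \<noteq> 0" using xs(1) by (simp add: walk_def)
  ultimately show ?thesis
    using xs(4) by (simp add: one_enat_def)
qed simp

lemma graph_dist_edge:
  assumes "u \<noteq> v" "{u, v} \<in> S"
  shows "graph_dist S u v = 1"
proof (rule antisym)
  have "graph_dist S u v \<le> enat (length [u, v] - 1)"
    unfolding graph_dist_def using assms by (intro INF_lower) (simp add: walk_def)
  then show "graph_dist S u v \<le> 1" by (simp add: one_enat_def)
next
  show "1 \<le> graph_dist S u v"
    unfolding graph_dist_def
  proof (rule INF_greatest, clarify)
    fix xs assume xs: "walk S xs" "u = hd xs" "v = last xs"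
    then have "length xs \<ge> 2"
      using assms(1) by (cases xs; cases "tl xs") (auto simp: walk_def)
    then show "1 \<le> enat (length xs - 1)" by (simp add: one_enat_def)
  qed
qed

text \<open>The threshold \<open>2k - 1\<close> separates two cases: an edge of \<open>S\<close> has
  distance 1, so the upper bound keeps \<open>Q\<close> at most \<open>2k - 1\<close>; an edge of
  \<open>E\<close> outside \<open>S\<close> has distance at least \<open>2k + 1\<close>, and
  \<open>Q\<close> is no smaller.\<close>

lemma distance_oracle_edge_iff:
  assumes "distance_oracle n (2 * real k - 1) S Q" "S \<subseteq> E" "enat (2 * k + 2) \<le> girth E"
    and "u < n" "v < n" "u \<noteq> v" "{u, v} \<in> E"
  shows "{u, v} \<in> S \<longleftrightarrow> Q u v \<le> ereal (2 * real k - 1)"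
proof
  assume "{u, v} \<in> S"
  then have "graph_dist S u v = 1" by (rule graph_dist_edge[OF assms(6)])
  moreover have "Q u v \<le> ereal (2 * real k - 1) * ereal_of_enat (graph_dist S u v)"
    using assms(1,4,5) by (simp add: distance_oracle_def)
  ultimately show "Q u v \<le> ereal (2 * real k - 1)"
    by (simp add: one_enat_def one_ereal_def[symmetric])
next
  assume Q: "Q u v \<le> ereal (2 * real k - 1)"
  show "{u, v} \<in> S"
  proof (rule ccontr)
    assume "{u, v} \<notin> S"
    then have "enat (2 * k + 2) \<le> graph_dist S u v + 1"
      using girth_le_graph_dist_Suc[OF assms(6,2,7)] assms(3) order_trans by blast
    moreover have "ereal_of_enat (graph_dist S u v) \<le> ereal (2 * real k - 1)"
      using assms(1,4,5) Q order_trans unfolding distance_oracle_def by blast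
    ultimately show False
      by (cases "graph_dist S u v") (auto simp: one_enat_def)
  qed
qed

text \<open>The threshold test mentions only \<open>Q\<close>, so it recovers the subgraph edge by
  edge.\<close>

lemma distance_oracle_inj:
  assumes "distance_oracle n (2 * real k - 1) S Q" "distance_oracle n (2 * real k - 1) T Q"
    and "S \<subseteq> E" "T \<subseteq> E" "E \<subseteq> all_edges n" "enat (2 * k + 2) \<le> girth E"
  shows "S = T"
proof -
  have "e \<in> S \<longleftrightarrow> e \<in> T" if "e \<in> E" for e
  proof -
    have "e \<subseteq> {..<n}" "card e = 2"
      using that assms(5) by (auto simp: all_edges_def)
    then obtain u v where "e = {u, v}" "u \<noteq> v" "u < n" "v < n"
      by (auto simp: card_2_iff)
    then show ?thesis
      using distance_oracle_edge_iff[of n k S Q E u v] distance_oracle_edge_iff[of n k T Q E u v]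
        assms that by blast
  qed
  with assms(3,4) show ?thesis by blast
qed

text \<open>Results are leaves of the coordinator's decision tree, which branches only when a bit is
  read. \<open>A\<close>, \<open>B\<close> and \<open>h\<close> vary in the induction because each
  step may restrict the inputs, lower the budget and extend the history.\<close>

lemma card_run_results_le:
  assumes "\<forall>E\<in>A. snd (run c \<sigma> E h) \<le> B"
  shows "finite ((\<lambda>E. fst (run c \<sigma> E h)) ` A) \<and> card ((\<lambda>E. fst (run c \<sigma> E h)) ` A) \<le> 2 ^ B"
  using assms
proof (induction c arbitrary: A B h)
  case (Output r)
  have sub: "(\<lambda>E. fst (run (Output r) \<sigma> E h)) ` A \<subseteq> {r}" by auto
  have "card ((\<lambda>E. fst (run (Output r) \<sigma> E h)) ` A) \<le> 1"
    using card_mono[OF _ sub] by simp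
  also have "1 \<le> (2::nat) ^ B" by simp
  finally show ?case using finite_subset[OF sub] by blast
next
  case (Send i b c)
  have "\<forall>E\<in>A. snd (run c \<sigma> E (h(i := h i @ [From_Coordinator b]))) \<le> B"
    using Send.prems by auto
  then show ?case using Send.IH by simp
next
  case (Receive i f)
  \<comment> \<open>The inputs are split by the bit that player \<open>i\<close> answers. Within one
    class the subtree and the history are the same for all inputs, as the induction hypothesis
    requires.\<close>
  define A' where "A' b = {E \<in> A. \<sigma> i (E i) (h i) = b}" for b
  define X where "X b = (\<lambda>E. fst (run (f b) \<sigma> E (h(i := h i @ [From_Player b])))) ` A' b" for b
  have eq: "(\<lambda>E. fst (run (Receive i f) \<sigma> E h)) ` A = X True \<union> X False"
    by (auto simp: X_def A'_def image_iff) metis+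
  show ?case
  proof (cases "A = {}")
    case False
    \<comment> \<open>Some input pays for this read, so the budget is positive and each branch keeps
      one bit less.\<close>
    then obtain B' where B: "B = Suc B'"
      using Receive.prems by (cases B) auto
    have X: "finite (X b) \<and> card (X b) \<le> 2 ^ B'" for b
      unfolding X_def
    proof (rule Receive.IH)
      show "\<forall>E\<in>A' b. snd (run (f b) \<sigma> E (h(i := h i @ [From_Player b]))) \<le> B'"
        using Receive.prems by (auto simp: A'_def B)
    qed simp
    have "card (X True \<union> X False) \<le> card (X True) + card (X False)"
      by (rule card_Un_le)
    also have "\<dots> \<le> 2 ^ B" using X[of True] X[of False] by (simp add: B)
    finally show ?thesis unfolding eq using X by blast
  qed simp
qed

text \<open>No result is admissible for two members of \<open>A\<close>. With fewer than
  \<open>m\<close> bits, a deterministic protocol is thus correct on at most half of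
  \<open>A\<close>, whereas random choice must average at least two thirds.\<close>

lemma cost_ge_of_fooling_set:
  assumes "solves n s P \<rho>" "A \<subseteq> inputs n s" "card A = 2 ^ m"
    and inj: "\<And>E E' r. E \<in> A \<Longrightarrow> E' \<in> A \<Longrightarrow> P (\<Union>i<s. E i) r \<Longrightarrow> P (\<Union>i<s. E' i) r \<Longrightarrow> E = E'"
  shows "enat m \<le> cost n s \<rho>"
proof (rule ccontr)
  assume "\<not> enat m \<le> cost n s \<rho>"
  then have "cost n s \<rho> < enat m" by simp
  then have less: "bits D E < m" if "D \<in> set_pmf \<rho>" "E \<in> inputs n s" for D E
  proof -
    have "enat (bits D E) \<le> cost n s \<rho>"
      unfolding cost_def using that by (meson SUP_upper SUP_upper2)
    also note \<open>cost n s \<rho> < enat m\<close>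
    finally show ?thesis by simp
  qed
  have "finite A" using assms(3) by (intro card_ge_0_finite) simp
  have "A \<noteq> {}" using assms(3) by auto
  obtain D0 where "D0 \<in> set_pmf \<rho>" using set_pmf_not_empty by fast
  \<comment> \<open>This makes \<open>m - 1\<close> a genuine predecessor, so that
    \<open>2 ^ (m - 1)\<close> is half of \<open>card A\<close>.\<close>
  then have "0 < m" using less \<open>A \<noteq> {}\<close> assms(2) by fastforce
  define W where "W E = {D. P (\<Union>i<s. E i) (result D E)}" for E
  have correct: "(\<Sum>E\<in>A. indicator (W E) D) \<le> (2 ^ (m - 1) :: real)" if D: "D \<in> set_pmf \<rho>" for D
  proof -
    define C where "C = {E \<in> A. D \<in> W E}"
    have "\<forall>E\<in>C. snd (run (fst D) (snd D) E (\<lambda>i. [])) \<le> m - 1"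
      using less[OF D] assms(2) by (fastforce simp: C_def bits_def)
    from card_run_results_le[OF this] have "card (result D ` C) \<le> 2 ^ (m - 1)"
      by (simp add: result_def[abs_def])
    \<comment> \<open>Correctly answered inputs have different results, so there are no more of them
      than results.\<close>
    moreover have "inj_on (result D) C"
      by (rule inj_onI) (metis (mono_tags, lifting) C_def W_def inj mem_Collect_eq)
    ultimately have "card C \<le> 2 ^ (m - 1)" by (simp add: card_image)
    moreover have "(\<Sum>E\<in>A. indicator (W E) D) = real (card C)"
      using \<open>finite A\<close> by (simp add: C_def indicator_def sum.If_cases Int_def)
    ultimately show ?thesis by simp
  qed
  \<comment> \<open>The expected number of correctly answered inputs is bounded from both sides,
    using linearity of expectation.\<close>
  have "(2 / 3) * 2 ^ m = (\<Sum>E\<in>A. 2 / 3 :: real)" using assms(3) by simp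
  also have "\<dots> \<le> (\<Sum>E\<in>A. measure_pmf.prob \<rho> (W E))"
    using assms(1,2) unfolding solves_def W_def by (intro sum_mono) blast
  also have "\<dots> = measure_pmf.expectation \<rho> (\<lambda>D. \<Sum>E\<in>A. indicator (W E) D)"
    by (subst Bochner_Integration.integral_sum) (auto simp: measure_pmf.emeasure_eq_measure)
  also have "\<dots> \<le> 2 ^ (m - 1)"
    using correct
    by (intro measure_pmf.integral_le_const)
      (simp_all add: AE_measure_pmf_iff measure_pmf.emeasure_eq_measure)
  also have "\<dots> = (1 / 2) * 2 ^ m"
    using \<open>0 < m\<close> by (cases m) auto
  finally show False by simp
qed

lemma card_le_randomized_cost_distance_oracle:
  assumes "H \<subseteq> all_edges n" "enat (2 * k + 2) \<le> girth H" "s \<ge> 1"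
  shows "enat (card H) \<le> randomized_cost n s (distance_oracle n (2 * real k - 1))"
  unfolding randomized_cost_def
proof (rule INF_greatest, clarify)
  fix \<rho> assume sol: "solves n s (distance_oracle n (2 * real k - 1)) \<rho>"
  \<comment> \<open>Player 0 holds the whole subgraph and the others nothing. The edge sets are then
    disjoint, and one argument covers every \<open>s \<ge> 1\<close>.\<close>
  define inp :: "nat set set \<Rightarrow> nat \<Rightarrow> nat set set" where "inp S i = (if i = 0 then S else {})" for S i
  have Union: "(\<Union>i<s. inp S i) = S" for S
    using assms(3) by (auto simp: inp_def split: if_splits)
  have "finite H"
    using assms(1) by (rule finite_subset) (rule finite_subset[of _ "Pow {..<n}"], auto simp: all_edges_def)
  have "inj inp"
    by (rule injI) (metis inp_def)
  show "enat (card H) \<le> cost n s \<rho>"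
  proof (rule cost_ge_of_fooling_set[OF sol])
    show "inp ` Pow H \<subseteq> inputs n s"
      using assms(1) by (auto simp: inputs_def inp_def disjoint_family_on_def split: if_splits)
    show "card (inp ` Pow H) = 2 ^ card H"
      using \<open>finite H\<close> \<open>inj inp\<close> by (simp add: card_image inj_on_subset card_Pow)
  next
    fix E E' Q
    assume "E \<in> inp ` Pow H" "E' \<in> inp ` Pow H"
    then obtain S T where ST: "E = inp S" "E' = inp T" "S \<subseteq> H" "T \<subseteq> H" by blast
    assume "distance_oracle n (2 * real k - 1) (\<Union>i<s. E i) Q"
      and "distance_oracle n (2 * real k - 1) (\<Union>i<s. E' i) Q"
    then have "S = T"
      unfolding ST Union using ST(3,4) assms(1,2) by (rule distance_oracle_inj)
    then show "E = E'" by (simp add: ST)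
  qed
qed

theorem theorem4p12:
  fixes k :: nat and G :: "nat \<Rightarrow> nat set set"
  assumes "k \<ge> 1"
    and "\<forall>\<^sub>F n in sequentially. G n \<subseteq> all_edges n \<and> girth (G n) = enat (2 * k + 2)"
    and "(\<lambda>n. real (card (G n))) \<in> \<Omega>(\<lambda>n. real n powr (1 + 1 / real k))"
  shows "\<exists>c::real>0. \<forall>\<^sub>F n in sequentially. \<forall>s\<ge>1.
           ereal (c * real n powr (1 + 1 / real k))
             \<le> ereal_of_enat (randomized_cost n s (distance_oracle n (2 * real k - 1)))"
proof -
  \<comment> \<open>The constant of the edge-count hypothesis serves unchanged, since the cost is at
    least \<open>card (G n)\<close> itself for every \<open>s \<ge> 1\<close>.\<close>
  obtain c where "c > 0"
    and ev: "\<forall>\<^sub>F n in sequentially.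
      c * norm (real n powr (1 + 1 / real k)) \<le> norm (real (card (G n)))"
    using landau_omega.bigE[OF assms(3)] by metis
  have "\<forall>\<^sub>F n in sequentially. \<forall>s\<ge>1.
           ereal (c * real n powr (1 + 1 / real k))
             \<le> ereal_of_enat (randomized_cost n s (distance_oracle n (2 * real k - 1)))"
    using assms(2) ev
  proof eventually_elim
    case (elim n)
    show ?case
    proof (intro allI impI)
      fix s :: nat assume "s \<ge> 1"
      have "ereal (c * real n powr (1 + 1 / real k)) \<le> ereal_of_enat (enat (card (G n)))"
        using elim(2) by simp
      also have "\<dots> \<le> ereal_of_enat (randomized_cost n s (distance_oracle n (2 * real k - 1)))"
        unfolding ereal_of_enat_le_iff
        using elim(1) \<open>s \<ge> 1\<close> by (intro card_le_randomized_cost_distance_oracle) auto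
      finally show "ereal (c * real n powr (1 + 1 / real k))
        \<le> ereal_of_enat (randomized_cost n s (distance_oracle n (2 * real k - 1)))" .
    qed
  qed
  with \<open>c > 0\<close> show ?thesis by blast
qed

end
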